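(* There is a non-empty open family of single table polygons each having an isolated periodic symplectic billiard orbit. Here "open family" means: a non-empty open subset of the space of convex quadrilaterals up to affine transformations; equivalently, there is a non-empty open set $U\subset(\mathbb{R}^2)^4$ of vertex tuples $(v_1,v_2,v_3,v_4)$ of convex quadrilaterals, invariant under simultaneous application of invertible affine transformations of $\mathbb{R}^2$, such that for every $(v_1,v_2,v_3,v_4)\in U$ the quadrilateral $P$ with consecutive vertices $v_1,v_2,v_3,v_4$ has an isolated periodic symplectic billiard orbit.
   Context: Let $P\subset\mathbb{R}^2$ be a convex polygon (a closed polygonal curve) with vertex set $V$, no three consecutive vertices collinear, and let $\mathrm{int}(P)$ be the bounded component of $\mathbb{R}^2\setminus P$. Edges are open segments between consecutive vertices. For $y\in P\setminus V$, $T_yP\subset\mathbb{R}^2$ is the linear line parallel to the edge containing $y$. For points $a,b$, $ab$ is the open segment between them. Single table symplectic billiards on $P$: let $\mathcal{P}_{\max}$ be the set of $(x,y)\in P\times P$ such that $y\notin V$ and there is exactly one $z\in P\cap\{x+t:t\in T_yP,t\ne0\}$ with $xz\subset\mathrm{int}(P)$; put $\phi(x,y)=(y,z)$. Let $\sigma(x,y)=(y,x)$, $N_0=P\times V$, $N_{i+1}=\phi^{-1}(N_i)$ (preimage) for $i\ge0$, $N=\bigcup_{i\ge0}N_i\cup\sigma(\bigcup_{i\ge0}N_i)$, and let the phase space be $\mathcal{P}=\mathcal{P}_{\max}\setminus N$; $\phi$ restricts to a bijection of $\mathcal{P}$. For $(x_0,x_1)\in\mathcal{P}$ the orbit is $(\phi^k(x_0,x_1))_{k\in\mathbb{Z}}=(x_k,x_{k+1})_{k\in\mathbb{Z}}$,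 and the trajectory is $(x_k)_{k\in\mathbb{Z}}$. The orbit is periodic if $\phi^n(x_0,x_1)=(x_0,x_1)$ for some $n\ge1$. The symbolic trajectory of $(x_0,x_1)\in\mathcal{P}$ is the bi-infinite sequence of edges of $P$ containing the points $x_k$, $k\in\mathbb{Z}$. A tile is an equivalence class of points of $\mathcal{P}$ having the same symbolic trajectory. A periodic orbit is called isolated if the tile containing its starting point has zero area in phase space (with respect to the product of arc-length measures on $P\times P$, equivalently with respect to any measure weighting the products of two edges by positive constants). *)

theory Defs
  imports "HOL-Analysis.Analysis"
begin

text \<open>A polygon is given by the cyclically ordered list \<open>vs\<close> of its consecutive vertices;
  its vertex set is \<open>set vs\<close>.\<close>

definition vertex :: "(real^2) list \<Rightarrow> nat \<Rightarrow> real^2" where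
  "vertex vs i = vs ! (i mod length vs)"

definition polygon_edges :: "(real^2) list \<Rightarrow> (real^2) set set" where
  "polygon_edges vs = {open_segment (vertex vs i) (vertex vs (i + 1)) | i. i < length vs}"

definition polygon_curve :: "(real^2) list \<Rightarrow> (real^2) set" where
  "polygon_curve vs = (\<Union>i<length vs. closed_segment (vertex vs i) (vertex vs (i + 1)))"

text \<open>The last condition says that the closed polygonal curve bounds a convex region; it rules out
  self-crossing and reflex vertices, and with the other conditions it forces the listed vertices to
  be exactly the corners of the region, in cyclic order.\<close>

definition convex_polygon :: "(real^2) list \<Rightarrow> bool" where
  "convex_polygon vs \<longleftrightarrow>
     3 \<le> length vs \<and> distinct vs \<and>
     (\<forall>i<length vs. \<not> collinear {vertex vs i, vertex vs (i + 1), vertex vs (i + 2)}) \<and>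
     polygon_curve vs = frontier (convex hull (set vs))"

text \<open>The next two notions are meaningful for points of the polygon that are not vertices.\<close>

definition edge_containing :: "(real^2) list \<Rightarrow> real^2 \<Rightarrow> (real^2) set" where
  "edge_containing vs y = (THE E. E \<in> polygon_edges vs \<and> y \<in> E)"

definition tangent_line :: "(real^2) list \<Rightarrow> real^2 \<Rightarrow> (real^2) set" where
  "tangent_line vs y = span {p - q | p q. p \<in> edge_containing vs y \<and> q \<in> edge_containing vs y}"

definition next_points :: "(real^2) list \<Rightarrow> (real^2) \<times> (real^2) \<Rightarrow> (real^2) set" where
  "next_points vs = (\<lambda>(x, y).
     {z \<in> polygon_curve vs \<inter> {x + t | t. t \<in> tangent_line vs y \<and> t \<noteq> 0}.
        open_segment x z \<subseteq> inside (polygon_curve vs)})"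

definition max_phase_space :: "(real^2) list \<Rightarrow> ((real^2) \<times> (real^2)) set" where
  "max_phase_space vs =
     {(x, y) \<in> polygon_curve vs \<times> polygon_curve vs. y \<notin> set vs \<and> (\<exists>!z. z \<in> next_points vs (x, y))}"

text \<open>Meaningful on \<^term>\<open>max_phase_space vs\<close> only.\<close>

definition billiard_map ::
    "(real^2) list \<Rightarrow> (real^2) \<times> (real^2) \<Rightarrow> (real^2) \<times> (real^2)" where
  "billiard_map vs = (\<lambda>(x, y). (y, THE z. z \<in> next_points vs (x, y)))"

primrec singular_set :: "(real^2) list \<Rightarrow> nat \<Rightarrow> ((real^2) \<times> (real^2)) set" where
  "singular_set vs 0 = polygon_curve vs \<times> set vs"
| "singular_set vs (Suc i) = {p \<in> max_phase_space vs. billiard_map vs p \<in> singular_set vs i}"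

definition phase_space :: "(real^2) list \<Rightarrow> ((real^2) \<times> (real^2)) set" where
  "phase_space vs =
     max_phase_space vs - ((\<Union>i. singular_set vs i) \<union> prod.swap ` (\<Union>i. singular_set vs i))"

text \<open>Negative iterates use that the billiard map is a bijection of the phase space onto itself.\<close>

definition orbit :: "(real^2) list \<Rightarrow> (real^2) \<times> (real^2) \<Rightarrow> int \<Rightarrow> (real^2) \<times> (real^2)" where
  "orbit vs p k =
     (if 0 \<le> k then (billiard_map vs ^^ nat k) p
      else (inv_into (phase_space vs) (billiard_map vs) ^^ nat (- k)) p)"

definition trajectory :: "(real^2) list \<Rightarrow> (real^2) \<times> (real^2) \<Rightarrow> int \<Rightarrow> real^2" where
  "trajectory vs p k = fst (orbit vs p k)"

definition symbolic_trajectory ::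
    "(real^2) list \<Rightarrow> (real^2) \<times> (real^2) \<Rightarrow> int \<Rightarrow> (real^2) set" where
  "symbolic_trajectory vs p k = edge_containing vs (trajectory vs p k)"

definition tile :: "(real^2) list \<Rightarrow> (real^2) \<times> (real^2) \<Rightarrow> ((real^2) \<times> (real^2)) set" where
  "tile vs p = {q \<in> phase_space vs. symbolic_trajectory vs q = symbolic_trajectory vs p}"

text \<open>Edge \<open>i\<close> is parametrised linearly over the unit interval, with constant speed equal to its
  length; the arc-length measure is the image of the speed-weighted Lebesgue measure.\<close>

definition edge_param :: "(real^2) list \<Rightarrow> nat \<Rightarrow> real \<Rightarrow> real^2" where
  "edge_param vs i t = (1 - t) *\<^sub>R vertex vs i + t *\<^sub>R vertex vs (i + 1)"

definition arc_length :: "(real^2) list \<Rightarrow> (real^2) measure" where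
  "arc_length vs =
     distr
       (density (count_space {..<length vs} \<Otimes>\<^sub>M restrict_space lborel {0..1})
          (\<lambda>(i, t). ennreal (dist (vertex vs i) (vertex vs (i + 1)))))
       borel (\<lambda>(i, t). edge_param vs i t)"

lemma measurable_edge_param:
  "(\<lambda>(i, t). edge_param vs i t)
     \<in> borel_measurable (count_space {..<length vs} \<Otimes>\<^sub>M restrict_space lborel {0..1})"
proof -
  have "(\<lambda>t. edge_param vs i t) \<in> borel_measurable (restrict_space lborel {0..1})" for i
    unfolding edge_param_def by (intro measurable_restrict_space1) measurable
  then show ?thesis
    by (intro measurable_pair_measure_countable1) (auto simp: countable_finite)
qed

text \<open>This confirms that the measure above is arc length.\<close>

lemma emeasure_arc_length:
  assumes A: "A \<in> sets borel"
  shows "emeasure (arc_length vs) A =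
    (\<Sum>i<length vs. ennreal (dist (vertex vs i) (vertex vs (i + 1))) *
        emeasure lborel {t \<in> {0..1}. edge_param vs i t \<in> A})"
proof -
  let ?n = "length vs"
  let ?L = "restrict_space lborel {0..1::real}"
  let ?M = "count_space {..<?n} \<Otimes>\<^sub>M ?L"
  let ?d = "\<lambda>i. ennreal (dist (vertex vs i) (vertex vs (i + 1)))"
  interpret L: sigma_finite_measure ?L
    by (intro sigma_finite_measure_restrict_space sigma_finite_lborel) auto
  have d[measurable]: "(\<lambda>(i, t). ?d i) \<in> borel_measurable ?M"
    by (intro measurable_pair_measure_countable1) (auto simp: countable_finite)
  let ?B = "(\<lambda>(i, t). edge_param vs i t) -` A \<inter> space ?M"
  have B[measurable]: "?B \<in> sets ?M"
    using measurable_edge_param A by (rule measurable_sets)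
  have S: "{t \<in> {0..1}. edge_param vs i t \<in> A} \<in> sets lborel" for i
  proof -
    have "(\<lambda>t. edge_param vs i t) \<in> borel_measurable lborel"
      unfolding edge_param_def by measurable
    from measurable_sets[OF this A]
    have "((\<lambda>t. edge_param vs i t) -` A) \<inter> {0..1} \<in> sets lborel" by (auto intro: sets.Int)
    moreover have "((\<lambda>t. edge_param vs i t) -` A) \<inter> {0..1} = {t \<in> {0..1}. edge_param vs i t \<in> A}"
      by auto
    ultimately show ?thesis by simp
  qed
  have "emeasure (arc_length vs) A = (\<integral>\<^sup>+p. (case p of (i, t) \<Rightarrow> ?d i) * indicator ?B p \<partial>?M)"
    unfolding arc_length_def using measurable_edge_param A B d
    by (simp add: emeasure_distr emeasure_density)
  also have "\<dots> = (\<integral>\<^sup>+i. \<integral>\<^sup>+t. ?d i * indicator ?B (i, t) \<partial>?L \<partial>count_space {..<?n})"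
    using L.nn_integral_fst[OF borel_measurable_times_ennreal[OF d borel_measurable_indicator[OF B]]]
    by simp
  also have "\<dots> = (\<Sum>i<?n. \<integral>\<^sup>+t. ?d i * indicator ?B (i, t) \<partial>?L)"
    by (subst nn_integral_count_space_finite) auto
  also have "\<dots> = (\<Sum>i<?n. ?d i * emeasure lborel {t \<in> {0..1}. edge_param vs i t \<in> A})"
  proof (intro sum.cong refl)
    fix i assume i: "i \<in> {..<?n}"
    have "(\<integral>\<^sup>+t. ?d i * indicator ?B (i, t) \<partial>?L)
        = (\<integral>\<^sup>+t. ?d i * indicator {t \<in> {0..1}. edge_param vs i t \<in> A} t \<partial>lborel)"
      by (subst nn_integral_restrict_space)
        (auto intro!: nn_integral_cong simp: indicator_def space_pair_measure space_restrict_space i[simplified])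
    also have "\<dots> = ?d i * emeasure lborel {t \<in> {0..1}. edge_param vs i t \<in> A}"
      using S by (rule nn_integral_cmult_indicator)
    finally show "(\<integral>\<^sup>+t. ?d i * indicator ?B (i, t) \<partial>?L)
        = ?d i * emeasure lborel {t \<in> {0..1}. edge_param vs i t \<in> A}" .
  qed
  finally show ?thesis .
qed

text \<open>Zero area is stated with \<^const>\<open>null_sets\<close>, since \<^const>\<open>emeasure\<close> vanishes on non-measurable
  sets by convention.\<close>

definition isolated_periodic :: "(real^2) list \<Rightarrow> (real^2) \<times> (real^2) \<Rightarrow> bool" where
  "isolated_periodic vs p \<longleftrightarrow>
     p \<in> phase_space vs \<and> (\<exists>n\<ge>1. (billiard_map vs ^^ n) p = p) \<and>
     tile vs p \<in> null_sets (completion (arc_length vs \<Otimes>\<^sub>M arc_length vs))"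

end

theory Submission
  imports Defs
begin

text \<open>
  Every quadrilateral is affinely equivalent to one with vertices \<open>(1,0)\<close>, \<open>(p,q)\<close>, \<open>(0,1)\<close>, \<open>(0,0)\<close>,
  and the family consists of those with \<open>1/2 < p, q < 1\<close>. The billiard map sends \<open>(x\<^sub>0, x\<^sub>1)\<close> to
  \<open>(x\<^sub>1, x\<^sub>2)\<close>, where \<open>x\<^sub>2\<close> depends affinely on \<open>x\<^sub>0\<close> once the edges are known, so along a fixed
  edge sequence the points of even and of odd index evolve independently. For the edge sequence
  \<open>0, 2, 3, 1, 2, 3\<close> six steps act on the even points by an affine map of slope
  \<open>- (1 - p) (1 - q) / (p q)\<close> and on the odd points by one of the inverse slope. The fixed points of
  these two maps lie on the correct open edges and form an orbit of period 6. Since the odd map is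
  expanding, a point with the same forward symbolic trajectory must have the same second component;
  the tile is therefore contained in a set \<open>UNIV \<times> {y}\<close>, which has zero area.
\<close>

section \<open>Convex polygons and arc length\<close>

lemma inside_polygon_curve:
  assumes "convex_polygon vs"
  shows "inside (polygon_curve vs) = interior (convex hull set vs)"
  using assms unfolding convex_polygon_def
  by (simp add: inside_frontier_eq_interior finite_imp_bounded_convex_hull convex_convex_hull)

lemma scaled_in_open_segment:
  fixes x v :: "'a::real_vector"
  assumes "v \<noteq> 0" "0 < r" "r < 1"
  shows "x + r *\<^sub>R v \<in> open_segment x (x + v)"
  using assms unfolding in_segment by (auto intro!: exI[of _ r] simp: algebra_simps)

lemma span_differences_open_segment:
  fixes a b :: "'a::real_vector"
  assumes "a \<noteq> b"
  shows "span {p - q | p q. p \<in> open_segment a b \<and> q \<in> open_segment a b} = span {b - a}"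
    (is "span ?S = _")
proof (rule span_eq[THEN iffD2, OF conjI])
  show "?S \<subseteq> span {b - a}"
  proof clarify
    fix p q assume "p \<in> open_segment a b" "q \<in> open_segment a b"
    then obtain s t where "p = (1 - s) *\<^sub>R a + s *\<^sub>R b" "q = (1 - t) *\<^sub>R a + t *\<^sub>R b"
      unfolding in_segment by blast
    then have "p - q = (s - t) *\<^sub>R (b - a)" by (simp only:) (simp add: algebra_simps)
    then show "p - q \<in> span {b - a}" by (simp add: span_base span_scale)
  qed
  have "a + (3/4) *\<^sub>R (b - a) \<in> open_segment a b" "a + (1/4) *\<^sub>R (b - a) \<in> open_segment a b"
    using scaled_in_open_segment[of "b - a" "3/4" a] scaled_in_open_segment[of "b - a" "1/4" a] assms
    by simp_all
  then have "(a + (3/4) *\<^sub>R (b - a)) - (a + (1/4) *\<^sub>R (b - a)) \<in> ?S" by blast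
  then have "2 *\<^sub>R ((a + (3/4) *\<^sub>R (b - a)) - (a + (1/4) *\<^sub>R (b - a))) \<in> span ?S"
    by (intro span_scale span_base)
  moreover have "2 *\<^sub>R ((a + (3/4) *\<^sub>R (b - a)) - (a + (1/4) *\<^sub>R (b - a))) = b - a"
    by (simp add: scaleR_diff_left[symmetric] scaleR_2)
  ultimately show "{b - a} \<subseteq> span ?S" by simp
qed

text \<open>Two candidates lie on one line through \<open>x\<close>. If they are on the same side of
  \<open>x\<close>, the nearer one is in the open segment to the farther one, hence interior; if on
  opposite sides, \<open>x\<close> lies between interior points and is interior by convexity. Either
  way a boundary point would be interior.\<close>

lemma next_points_unique:
  assumes conv: "convex_polygon vs" and x: "x \<in> polygon_curve vs"
    and tl: "tangent_line vs y = span {d}"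
    and z: "z \<in> next_points vs (x, y)" and z': "z' \<in> next_points vs (x, y)"
  shows "z = z'"
proof (rule ccontr)
  assume "z \<noteq> z'"
  let ?K = "convex hull set vs"
  have curve: "polygon_curve vs = frontier ?K" using conv by (simp add: convex_polygon_def)
  note ins = inside_polygon_curve[OF conv]
  have disj: "m \<notin> interior ?K" if "m \<in> polygon_curve vs" for m
    using that curve by (simp add: frontier_def)
  obtain s where s: "z = x + s *\<^sub>R d" "s *\<^sub>R d \<noteq> 0"
    using z tl unfolding next_points_def span_singleton by auto
  obtain t where t: "z' = x + t *\<^sub>R d" "t *\<^sub>R d \<noteq> 0"
    using z' tl unfolding next_points_def span_singleton by auto
  have seg: "open_segment x z \<subseteq> interior ?K" "open_segment x z' \<subseteq> interior ?K"
    and zc: "z \<in> polygon_curve vs" "z' \<in> polygon_curve vs"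
    using z z' ins unfolding next_points_def by auto
  have "s \<noteq> t" "s \<noteq> 0" "t \<noteq> 0" "d \<noteq> 0" using \<open>z \<noteq> z'\<close> s t by auto
  have between: "x + r *\<^sub>R d \<in> open_segment x (x + k *\<^sub>R d)" if "0 < r / k" "r / k < 1" for r k
    using scaled_in_open_segment[of "k *\<^sub>R d" "r / k" x] that \<open>d \<noteq> 0\<close> by (cases "k = 0") auto
  consider "0 < s / t" "s / t < 1" | "0 < t / s" "t / s < 1" | "s / t < 0"
    using \<open>s \<noteq> t\<close> \<open>s \<noteq> 0\<close> \<open>t \<noteq> 0\<close>
    by (cases "s < 0"; cases "t < 0"; cases "s < t") (auto simp: divide_simps)
  then show False
  proof cases
    case 1
    then show ?thesis using between[of s t] seg zc disj s t by auto
  next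
    case 2
    then show ?thesis using between[of t s] seg zc disj s t by auto
  next
    case 3
    \<comment> \<open>Midpoints stand in for \<open>z\<close> and \<open>z'\<close>, which are
      themselves boundary points.\<close>
    have "x + (s/2) *\<^sub>R d \<in> interior ?K" "x + (t/2) *\<^sub>R d \<in> interior ?K"
      using between[of "s/2" s] between[of "t/2" t] seg s t \<open>s \<noteq> 0\<close> \<open>t \<noteq> 0\<close> by auto
    then have "open_segment (x + (s/2) *\<^sub>R d) (x + (t/2) *\<^sub>R d) \<subseteq> interior ?K"
      by (meson convex_contains_open_segment convex_interior convex_convex_hull)
    moreover have "x \<in> open_segment (x + (s/2) *\<^sub>R d) (x + (t/2) *\<^sub>R d)"
    proof -
      \<comment> \<open>\<open>s / (s - t)\<close> solves \<open>s/2 + r * (t - s)/2 = 0\<close>: it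
        is the parameter at which the segment between the midpoints passes \<open>x\<close>.\<close>
      let ?v = "((t - s) / 2) *\<^sub>R d"
      have r: "0 < s / (s - t)" "s / (s - t) < 1"
        using 3 by (auto simp: field_simps divide_less_0_iff zero_less_divide_iff)
      have "(s/2) *\<^sub>R d + (s / (s - t)) *\<^sub>R ?v = (s/2 + (s / (s - t)) * ((t - s)/2)) *\<^sub>R d"
        by (simp add: scaleR_add_left)
      also have "s/2 + (s / (s - t)) * ((t - s)/2) = 0" using \<open>s \<noteq> t\<close> by (simp add: field_simps)
      finally have "x + (s/2) *\<^sub>R d + (s / (s - t)) *\<^sub>R ?v = x" by (simp add: add.assoc)
      moreover have "x + (s/2) *\<^sub>R d + ?v = x + (t/2) *\<^sub>R d"
        by (simp add: add.assoc scaleR_add_left[symmetric]) (simp add: field_simps)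
      moreover have "x + (s/2) *\<^sub>R d + (s / (s - t)) *\<^sub>R ?v
          \<in> open_segment (x + (s/2) *\<^sub>R d) (x + (s/2) *\<^sub>R d + ?v)"
        using r \<open>s \<noteq> t\<close> \<open>d \<noteq> 0\<close> by (intro scaled_in_open_segment) auto
      ultimately show ?thesis by metis
    qed
    ultimately show ?thesis using disj[OF x] by blast
  qed
qed

section \<open>Null sets of the arc-length measure\<close>

text \<open>Each edge is parametrised injectively because its endpoints differ, so the point is hit
  at most once per edge.\<close>

lemma emeasure_arc_length_singleton:
  assumes "\<And>i. i < length vs \<Longrightarrow> vertex vs i \<noteq> vertex vs (i + 1)"
  shows "emeasure (arc_length vs) {a} = 0"
proof -
  have "{t \<in> {0..1}. edge_param vs i t \<in> {a}} \<in> null_sets lborel" if i: "i < length vs" for i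
  proof -
    have "finite {t \<in> {0..1}. edge_param vs i t \<in> {a}}"
    proof (cases "\<exists>t. edge_param vs i t = a")
      case True
      then obtain t where t: "edge_param vs i t = a" ..
      have "t' = t" if "edge_param vs i t' = a" for t'
      proof -
        have "(t' - t) *\<^sub>R (vertex vs (i + 1) - vertex vs i) = edge_param vs i t' - edge_param vs i t"
          unfolding edge_param_def by (simp add: algebra_simps)
        then show ?thesis using that t assms[OF i] by simp
      qed
      then have "{t' \<in> {0..1}. edge_param vs i t' \<in> {a}} \<subseteq> {t}" by auto
      then show ?thesis using finite_subset by blast
    qed auto
    then show ?thesis by (simp add: finite_imp_null_set_lborel)
  qed
  then show ?thesis by (simp add: emeasure_arc_length null_setsD1)
qed

lemma finite_measure_arc_length: "finite_measure (arc_length vs)"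
proof
  have "emeasure (arc_length vs) UNIV =
     (\<Sum>i<length vs. ennreal (dist (vertex vs i) (vertex vs (i + 1))) * 1)"
    by (simp add: emeasure_arc_length del: atLeastAtMost_iff sum_ennreal)
  also have "\<dots> < \<infinity>" by simp
  finally show "emeasure (arc_length vs) (space (arc_length vs)) \<noteq> \<infinity>"
    by (simp add: arc_length_def space_distr)
qed

text \<open>The strip is a rectangle with a null second factor; the completion then makes all its
  subsets null, Borel or not.\<close>

lemma null_sets_arc_length_strip:
  assumes "\<And>i. i < length vs \<Longrightarrow> vertex vs i \<noteq> vertex vs (i + 1)"
    and "T \<subseteq> UNIV \<times> {a}"
  shows "T \<in> null_sets (completion (arc_length vs \<Otimes>\<^sub>M arc_length vs))"
proof -
  interpret finite_measure "arc_length vs" by (rule finite_measure_arc_length)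
  have sets: "sets (arc_length vs) = sets borel" by (simp add: arc_length_def)
  have "emeasure (arc_length vs \<Otimes>\<^sub>M arc_length vs) (UNIV \<times> {a}) = 0"
    by (subst emeasure_pair_measure_Times)
      (simp_all add: sets emeasure_arc_length_singleton[OF assms(1)])
  then have "UNIV \<times> {a} \<in> null_sets (arc_length vs \<Otimes>\<^sub>M arc_length vs)"
    by (intro null_setsI) (simp_all add: sets)
  then show ?thesis using assms(2) null_sets_completion_subset null_sets_completionI by blast
qed

text \<open>The map \<open>t -> l * (1 - t)\<close> fixes \<open>l / (1 + l)\<close> and multiplies
  distances to this point by \<open>l\<close>, so every other starting value eventually leaves the
  unit interval.\<close>

lemma bounded_expanding_recurrence:
  fixes c :: "nat \<Rightarrow> real"
  assumes rec: "\<And>k. c (Suc k) = l * (1 - c k)" and l: "1 < l"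
    and bd: "\<And>k. 0 \<le> c k" "\<And>k. c k \<le> 1"
  shows "c 0 = l / (1 + l)"
proof (rule ccontr)
  define f where "f = l / (1 + l)"
  assume "c 0 \<noteq> l / (1 + l)"
  then have pos: "0 < \<bar>c 0 - f\<bar>" by (simp add: f_def)
  have fp: "l * (1 - f) = f" and f: "0 \<le> f" "f \<le> 1" using l by (simp_all add: f_def field_simps)
  have pow: "\<bar>c k - f\<bar> = l ^ k * \<bar>c 0 - f\<bar>" for k
  proof (induction k)
    case (Suc k)
    have "c (Suc k) - f = l * (1 - c k) - l * (1 - f)" by (simp only: rec fp)
    also have "\<dots> = l * (f - c k)" by (simp add: algebra_simps)
    finally have "c (Suc k) - f = l * (f - c k)" .
    then have "\<bar>c (Suc k) - f\<bar> = l * \<bar>c k - f\<bar>" using l by (metis abs_minus_commute abs_mult abs_of_pos less_trans zero_less_one)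
    then show ?case using Suc by simp
  qed simp
  \<comment> \<open>\<open>n\<close> is taken so large that the distance to the fixed point exceeds
    1, the diameter of the unit interval.\<close>
  obtain n where "1 / \<bar>c 0 - f\<bar> < l ^ n" using real_arch_pow[OF l] by blast
  then have "1 < \<bar>c n - f\<bar>" using pos unfolding pow[of n] by (simp add: pos_divide_less_eq)
  then show False using bd[of n] f by linarith
qed

section \<open>Quadrilaterals in affine coordinates\<close>

definition det2 :: "real^2 \<Rightarrow> real^2 \<Rightarrow> real" where
  "det2 a b = a$1 * b$2 - a$2 * b$1"

text \<open>The argument runs in an arbitrary frame with origin \<open>c\<close> and axes
  \<open>u\<close>, \<open>w\<close>. This takes the place of normalising the polygon by an affine
  map, which would require proving that the billiard map commutes with it.\<close>

locale affine_frame =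
  fixes c u w :: "real^2"
  assumes frame: "det2 u w \<noteq> 0"
begin

definition pt :: "real \<Rightarrow> real \<Rightarrow> real^2" where
  "pt x y = c + x *\<^sub>R u + y *\<^sub>R w"

text \<open>Cramer's rule: the coordinates are quotients of determinants, which is how
  \<open>family\<close> can describe them.\<close>

definition xc :: "real^2 \<Rightarrow> real" where "xc z = det2 (z - c) w / det2 u w"

definition yc :: "real^2 \<Rightarrow> real" where "yc z = det2 u (z - c) / det2 u w"

lemma xc_pt [simp]: "xc (pt x y) = x" and yc_pt [simp]: "yc (pt x y) = y"
  using frame unfolding xc_def yc_def pt_def det2_def by (simp_all add: field_simps)

lemma pt_coords [simp]: "pt (xc z) (yc z) = z"
proof -
  have "det2 u w *\<^sub>R pt (xc z) (yc z) = det2 u w *\<^sub>R z"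
    using frame unfolding pt_def xc_def yc_def
    by (simp add: scaleR_add_right) (simp add: det2_def vec_eq_iff forall_2 algebra_simps)
  then show ?thesis using frame by simp
qed

lemma pt_eq_iff [simp]: "pt x y = pt x' y' \<longleftrightarrow> x = x' \<and> y = y'"
  by (metis xc_pt yc_pt)

lemma ex_pt: "\<exists>x y. z = pt x y"
  by (metis pt_coords)

lemma pt_diff: "pt x y - pt x' y' = (x - x') *\<^sub>R u + (y - y') *\<^sub>R w"
  unfolding pt_def by (simp add: algebra_simps)

lemma pt_add: "pt x y + r *\<^sub>R (pt a b - pt a' b') = pt (x + r * (a - a')) (y + r * (b - b'))"
  unfolding pt_diff unfolding pt_def by (simp add: algebra_simps)

lemma pt_combination:
  "(1 - t) *\<^sub>R pt x y + t *\<^sub>R pt x' y' = pt ((1 - t) * x + t * x') ((1 - t) * y + t * y')"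
  unfolding pt_def by (simp add: algebra_simps)

lemma not_collinear_pt:
  assumes "(x1 - x2) * (y3 - y2) \<noteq> (y1 - y2) * (x3 - x2)"
  shows "\<not> collinear {pt x1 y1, pt x2 y2, pt x3 y3}"
proof
  assume "collinear {pt x1 y1, pt x2 y2, pt x3 y3}"
  then have "collinear {0, pt x1 y1 - pt x2 y2, pt x3 y3 - pt x2 y2}"
    by (subst (asm) collinear_3) (simp_all add: insert_commute)
  then have "pt x1 y1 = pt x2 y2 \<or> pt x3 y3 = pt x2 y2 \<or>
      (\<exists>r. pt x3 y3 - pt x2 y2 = r *\<^sub>R (pt x1 y1 - pt x2 y2))"
    by (simp add: collinear_lemma del: pt_eq_iff)
  then consider "pt x1 y1 = pt x2 y2" | "pt x3 y3 = pt x2 y2"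
    | r where "pt x3 y3 = pt x2 y2 + r *\<^sub>R (pt x1 y1 - pt x2 y2)"
    by (metis add.commute diff_add_cancel)
  then show False using assms by cases (simp_all add: pt_add)
qed

lemma continuous_on_xc: "continuous_on A xc" and continuous_on_yc: "continuous_on A yc"
  unfolding xc_def[abs_def] yc_def[abs_def] using frame
  unfolding det2_def by (auto intro!: continuous_intros)

end

lemma less_4_cases:
  assumes "i < (4::nat)"
  obtains "i = 0" | "i = 1" | "i = 2" | "i = 3"
  using assms by linarith

lemma all_less_4: "(\<forall>j<(4::nat). P j) \<longleftrightarrow> P 0 \<and> P 1 \<and> P 2 \<and> P 3"
  by (auto elim: less_4_cases)

section \<open>The normalised quadrilateral and its edges\<close>

locale quadrilateral = affine_frame +
  fixes p q :: real
  assumes p: "1/2 < p" "p < 1" and q: "1/2 < q" "q < 1"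
begin

definition vs :: "(real^2) list" where
  "vs = [pt 1 0, pt p q, pt 0 1, pt 0 0]"

text \<open>\<open>side i\<close> vanishes on the line through edge \<open>i\<close> and is positive inside the quadrilateral.\<close>

definition side :: "nat \<Rightarrow> real^2 \<Rightarrow> real" where
  "side i z =
    (if i = 0 then q - q * xc z - (1 - p) * yc z
     else if i = 1 then p - (1 - q) * xc z - p * yc z
     else if i = 2 then xc z else yc z)"

definition edge :: "nat \<Rightarrow> (real^2) set" where
  "edge i = open_segment (vertex vs i) (vertex vs (i + 1))"

definition dir :: "nat \<Rightarrow> real^2" where
  "dir i = vertex vs (i + 1) - vertex vs i"

definition slope :: "nat \<Rightarrow> nat \<Rightarrow> real" where
  "slope j i = side j (vertex vs (i + 1)) - side j (vertex vs i)"

lemma length_vs [simp]: "length vs = 4"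
  by (simp add: vs_def)

lemma vertex_simps [simp]:
  "vertex vs 0 = pt 1 0" "vertex vs (Suc 0) = pt p q" "vertex vs 2 = pt 0 1" "vertex vs 3 = pt 0 0"
  "vertex vs 4 = pt 1 0" "vertex vs 5 = pt p q"
  "vertex vs (Suc (Suc 0)) = pt 0 1" "vertex vs (Suc (Suc (Suc 0))) = pt 0 0"
  by (simp_all add: vertex_def vs_def)

lemma side_simps [simp]:
  "side 0 z = q - q * xc z - (1 - p) * yc z"
  "side (Suc 0) z = p - (1 - q) * xc z - p * yc z"
  "side 2 z = xc z"
  "side 3 z = yc z"
  by (simp_all add: side_def)

lemma side_combination:
  "side j ((1 - t) *\<^sub>R a + t *\<^sub>R b) = (1 - t) * side j a + t * side j b"
proof -
  obtain x y x' y' where ab: "a = pt x y" "b = pt x' y'" using ex_pt by metis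
  show ?thesis unfolding ab pt_combination side_def xc_pt yc_pt by (simp add: algebra_simps)
qed

lemma side_add_dir: "side j (z + r *\<^sub>R dir i) = side j z + r * slope j i"
proof -
  obtain x y x' y' x'' y'' where v: "z = pt x y" "vertex vs (i + 1) = pt x' y'" "vertex vs i = pt x'' y''"
    using ex_pt by metis
  show ?thesis unfolding dir_def slope_def v pt_add side_def xc_pt yc_pt by (simp add: algebra_simps)
qed

text \<open>No two edges are parallel. For the opposite pairs 0, 2 and 1, 3 this rests on
  \<open>p < 1\<close> and \<open>q < 1\<close>.\<close>

lemma slope_eq_0_iff: "i < 4 \<Longrightarrow> j < 4 \<Longrightarrow> slope j i = 0 \<longleftrightarrow> j = i"
  using p q by (elim less_4_cases) (simp_all add: slope_def algebra_simps)

text \<open>The level lines of \<open>side j\<close> are parallel to edge \<open>j\<close>, so being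
  reachable in the tangent direction becomes one linear equation.\<close>

lemma parallel_if_side_eq:
  assumes "j < 4" "side j z = side j x"
  obtains r where "z = x + r *\<^sub>R dir j"
proof -
  obtain a b a' b' where z: "z = pt a b" and x: "x = pt a' b'" using ex_pt by metis
  have "\<exists>r. z = x + r *\<^sub>R dir j"
    using assms(1)
  proof (cases rule: less_4_cases)
    case 1
    \<comment> \<open>The coefficient is read off a coordinate in which \<open>dir j\<close> does
      not vanish; likewise in the other cases.\<close>
    have "z = x + ((b - b') / q) *\<^sub>R dir j"
      using 1 assms(2) p q unfolding x z dir_def by (simp add: pt_add) (simp add: field_simps)
    then show ?thesis ..
  next
    case 2
    have "z = x + ((a' - a) / p) *\<^sub>R dir j"
      using 2 assms(2) p q unfolding x z dir_def by (simp add: pt_add) (simp add: field_simps)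
    then show ?thesis ..
  next
    case 3
    have "z = x + (b' - b) *\<^sub>R dir j"
      using 3 assms(2) unfolding x z dir_def by (simp add: pt_add)
    then show ?thesis ..
  next
    case 4
    have "z = x + (a - a') *\<^sub>R dir j"
      using 4 assms(2) unfolding x z dir_def by (simp add: pt_add)
    then show ?thesis ..
  qed
  then show thesis using that by blast
qed

lemma side_vertex:
  assumes i: "i < 4" and j: "j < 4"
  shows "0 \<le> side j (vertex vs i)" "0 \<le> side j (vertex vs (i + 1))"
    and "j \<noteq> i \<Longrightarrow> 0 < side j (vertex vs i) \<or> 0 < side j (vertex vs (i + 1))"
proof -
  have "\<forall>i<4. \<forall>j<4. 0 \<le> side j (vertex vs i) \<and> 0 \<le> side j (vertex vs (i + 1)) \<and>
    (j \<noteq> i \<longrightarrow> 0 < side j (vertex vs i) \<or> 0 < side j (vertex vs (i + 1)))"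
    unfolding all_less_4 using p q by (simp add: algebra_simps)
  then show "0 \<le> side j (vertex vs i)" "0 \<le> side j (vertex vs (i + 1))"
    and "j \<noteq> i \<Longrightarrow> 0 < side j (vertex vs i) \<or> 0 < side j (vertex vs (i + 1))"
    using i j by blast+
qed

lemma side_vertex_self:
  assumes "i < 4"
  shows "side i (vertex vs i) = 0" "side i (vertex vs (i + 1)) = 0"
  using assms by (cases rule: less_4_cases; simp add: algebra_simps)+

text \<open>\<open>k\<close> is the following edge and \<open>l\<close> the preceding one: each side
  vanishes at one end of edge \<open>i\<close> and is positive at the other, so the two signs locate
  a point between the ends.\<close>

lemma adjacent_sides:
  assumes "i < 4"
  obtains k l where "k < 4" "k \<noteq> i" "side k (vertex vs (i + 1)) = 0" "0 < side k (vertex vs i)"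
    and "l < 4" "l \<noteq> i" "side l (vertex vs i) = 0" "0 < side l (vertex vs (i + 1))"
  using assms
proof (cases rule: less_4_cases)
  case 1
  then show thesis using that[of 1 3] p q by (simp add: algebra_simps)
next
  case 2
  then show thesis using that[of 2 0] p q by (simp add: algebra_simps)
next
  case 3
  then show thesis using that[of 3 1] p q by (simp add: algebra_simps)
next
  case 4
  then show thesis using that[of 0 2] p q by (simp add: algebra_simps)
qed

lemma vertex_neq: "i < 4 \<Longrightarrow> vertex vs i \<noteq> vertex vs (i + 1)"
  by (metis adjacent_sides less_irrefl)

lemma mem_closed_edge:
  assumes i: "i < 4"
  shows "z \<in> closed_segment (vertex vs i) (vertex vs (i + 1)) \<longleftrightarrow>
    side i z = 0 \<and> (\<forall>j<4. 0 \<le> side j z)"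
proof
  assume "z \<in> closed_segment (vertex vs i) (vertex vs (i + 1))"
  then show "side i z = 0 \<and> (\<forall>j<4. 0 \<le> side j z)"
    using side_vertex[OF i] side_vertex_self[OF i] unfolding in_segment by (auto simp: side_combination simp del: One_nat_def)
next
  assume R: "side i z = 0 \<and> (\<forall>j<4. 0 \<le> side j z)"
  obtain r where "z = vertex vs i + r *\<^sub>R dir i"
    using parallel_if_side_eq[OF i, of z "vertex vs i"] R side_vertex_self(1)[OF i] by auto
  then have z: "z = (1 - r) *\<^sub>R vertex vs i + r *\<^sub>R vertex vs (i + 1)"
    by (simp add: dir_def algebra_simps)
  obtain k l where "k < 4" "side k (vertex vs (i + 1)) = 0" "0 < side k (vertex vs i)"
    and "l < 4" "side l (vertex vs i) = 0" "0 < side l (vertex vs (i + 1))"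
    using adjacent_sides[OF i] by metis
  moreover have "0 \<le> side k z" "0 \<le> side l z" using R calculation by auto
  \<comment> \<open>Along the line of edge \<open>i\<close>, \<open>side k\<close> is a positive
    multiple of \<open>1 - r\<close> and \<open>side l\<close> one of \<open>r\<close>.\<close>
  ultimately have "0 \<le> r" "r \<le> 1"
    unfolding z side_combination by (simp_all add: zero_le_mult_iff)
  then show "z \<in> closed_segment (vertex vs i) (vertex vs (i + 1))" unfolding in_segment z by blast
qed

text \<open>Strict positivity of the other sides removes the two endpoints, since a neighbouring
  side vanishes at each.\<close>

lemma mem_edge:
  assumes i: "i < 4"
  shows "z \<in> edge i \<longleftrightarrow> side i z = 0 \<and> (\<forall>j<4. j \<noteq> i \<longrightarrow> 0 < side j z)"
proof
  assume "z \<in> edge i"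
  then obtain t where t: "0 < t" "t < 1" and z: "z = (1 - t) *\<^sub>R vertex vs i + t *\<^sub>R vertex vs (i + 1)"
    unfolding edge_def in_segment by blast
  have "0 < (1 - t) * side j (vertex vs i) + t * side j (vertex vs (i + 1))" if "j < 4" "j \<noteq> i" for j
    using side_vertex[OF i \<open>j < 4\<close>] \<open>j \<noteq> i\<close> t
    by (auto intro: add_pos_nonneg add_nonneg_pos)
  then show "side i z = 0 \<and> (\<forall>j<4. j \<noteq> i \<longrightarrow> 0 < side j z)"
    using side_vertex_self[OF i] unfolding z side_combination by simp
next
  assume R: "side i z = 0 \<and> (\<forall>j<4. j \<noteq> i \<longrightarrow> 0 < side j z)"
  then have "z \<in> closed_segment (vertex vs i) (vertex vs (i + 1))"
    unfolding mem_closed_edge[OF i] by (metis less_eq_real_def order_refl)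
  moreover have "z \<noteq> vertex vs i" "z \<noteq> vertex vs (i + 1)"
    using R adjacent_sides[OF i] by (metis less_irrefl)+
  ultimately show "z \<in> edge i" unfolding edge_def by (simp add: open_segment_def)
qed

section \<open>Convex hull, interior and boundary in terms of sides\<close>

lemma continuous_on_side: "continuous_on A (side j)"
  using continuous_on_xc continuous_on_yc unfolding side_def[abs_def]
  by (cases "j = 0"; cases "j = 1"; cases "j = 2") (auto intro!: continuous_intros)

lemma open_interior_hull: "open {z. \<forall>j<4. 0 < side j z}"
  unfolding all_less_4
  by (intro open_Collect_conj open_Collect_less continuous_on_const continuous_on_side)

lemma convex_side_nonneg: "convex {z. \<forall>j<4. 0 \<le> side j z}"
  unfolding convex_alt by (auto simp: side_combination)

text \<open>The diagonal from \<open>pt 0 0\<close> to \<open>pt p q\<close> cuts the region of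
  nonnegative sides into two triangles; the sign of \<open>q * x - p * y\<close> decides which one
  contains \<open>z\<close>.\<close>

lemma convex_hull_vs: "convex hull (set vs) = {z. \<forall>j<4. 0 \<le> side j z}"
proof
  have "side j z \<ge> 0" if "z \<in> set vs" "j < 4" for z j
    using that p q by (elim less_4_cases) (auto simp: vs_def algebra_simps)
  then show "convex hull (set vs) \<subseteq> {z. \<forall>j<4. 0 \<le> side j z}"
    by (intro hull_minimal convex_side_nonneg) auto
  show "{z. \<forall>j<4. 0 \<le> side j z} \<subseteq> convex hull (set vs)"
  proof
    fix z assume "z \<in> {z. \<forall>j<4. 0 \<le> side j z}"
    moreover obtain x y where z: "z = pt x y" using ex_pt by blast
    ultimately have s: "0 \<le> x" "0 \<le> y" "q * x + (1 - p) * y \<le> q" "(1 - q) * x + p * y \<le> p"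
      unfolding all_less_4 by simp_all
    have comb: "pt (a * x' + b * p) (a * y' + b * q) \<in> convex hull (set vs)"
      if "pt x' y' \<in> set vs" "0 \<le> a" "0 \<le> b" "a + b \<le> 1" for a b x' y'
    proof -
      have "a *\<^sub>R pt x' y' + b *\<^sub>R pt p q + (1 - a - b) *\<^sub>R pt 0 0 = pt (a * x' + b * p) (a * y' + b * q)"
        unfolding pt_def by (simp add: algebra_simps)
      then have "pt (a * x' + b * p) (a * y' + b * q) \<in> convex hull {pt x' y', pt p q, pt 0 0}"
        unfolding convex_hull_3 using that by (smt (verit) mem_Collect_eq)
      also have "\<dots> \<subseteq> convex hull (set vs)" using that(1) by (intro hull_mono) (auto simp: vs_def)
      finally show ?thesis .
    qed
    show "z \<in> convex hull (set vs)"
    proof (cases "p * y \<le> q * x")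
      case True
      \<comment> \<open>The weights at \<open>pt p q\<close> and \<open>pt 1 0\<close> are
        \<open>y / q\<close> and \<open>x - p * y / q\<close>; nonnegativity of
        \<open>side 0\<close> says that their sum is at most 1.\<close>
      have "z = pt ((x - p * y / q) * 1 + (y / q) * p) ((x - p * y / q) * 0 + (y / q) * q)"
        unfolding z using q by (simp add: field_simps)
      moreover have "pt 1 0 \<in> set vs" by (simp add: vs_def)
      moreover have "0 \<le> x - p * y / q" "0 \<le> y / q" "x - p * y / q + y / q \<le> 1"
        using True s q by (simp_all add: field_simps)
      ultimately show ?thesis using comb by metis
    next
      case False
      have "z = pt ((y - q * x / p) * 0 + (x / p) * p) ((y - q * x / p) * 1 + (x / p) * q)"
        unfolding z using p by (simp add: field_simps)
      moreover have "pt 0 1 \<in> set vs" by (simp add: vs_def)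
      moreover have "0 \<le> y - q * x / p" "0 \<le> x / p" "y - q * x / p + x / p \<le> 1"
        using False s p by (simp_all add: field_simps)
      ultimately show ?thesis using comb by metis
    qed
  qed
qed

text \<open>An interior point can be pushed slightly away from a vertex \<open>b\<close> with
  \<open>0 < side j b\<close> without leaving the hull; if \<open>side j\<close> vanished at the
  point, it would become negative.\<close>

lemma interior_hull: "interior (convex hull (set vs)) = {z. \<forall>j<4. 0 < side j z}"
proof
  have "{z. \<forall>j<4. 0 < side j z} \<subseteq> convex hull (set vs)"
    unfolding convex_hull_vs using less_imp_le by blast
  then show "{z. \<forall>j<4. 0 < side j z} \<subseteq> interior (convex hull (set vs))"
    using open_interior_hull by (rule interior_maximal)
  show "interior (convex hull (set vs)) \<subseteq> {z. \<forall>j<4. 0 < side j z}"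
  proof (intro subsetI CollectI allI impI)
    fix z j assume z: "z \<in> interior (convex hull (set vs))" and j: "j < (4::nat)"
    have nonneg: "0 \<le> side j v" if "v \<in> interior (convex hull (set vs))" for v
    proof -
      have "v \<in> convex hull (set vs)" using that interior_subset by blast
      then show ?thesis using j unfolding convex_hull_vs by blast
    qed
    obtain k where "k < 4" "k \<noteq> j" using adjacent_sides[OF j] .
    then obtain b where b: "0 < side j b" using side_vertex(3)[OF \<open>k < 4\<close> j] by metis
    \<comment> \<open>Negative \<open>t\<close> moves \<open>z\<close> away from
      \<open>b\<close>.\<close>
    have "((\<lambda>t. (1 - t) *\<^sub>R z + t *\<^sub>R b) \<longlongrightarrow> (1 - 0) *\<^sub>R z + 0 *\<^sub>R b) (at_left (0::real))"
      by (intro tendsto_intros)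
    then have "\<forall>\<^sub>F t in at_left (0::real). (1 - t) *\<^sub>R z + t *\<^sub>R b \<in> interior (convex hull (set vs))"
      by (rule topological_tendstoD[OF _ open_interior]) (use z in simp)
    moreover have "\<forall>\<^sub>F t in at_left (0::real). t < 0"
      by (simp add: eventually_at_filter)
    ultimately have "\<forall>\<^sub>F t in at_left (0::real). t < 0 \<and> (1 - t) *\<^sub>R z + t *\<^sub>R b \<in> interior (convex hull (set vs))"
      by eventually_elim (rule conjI)
    then obtain t :: real where t: "t < 0" and "(1 - t) *\<^sub>R z + t *\<^sub>R b \<in> interior (convex hull (set vs))"
      by (metis (no_types, lifting) eventually_happens' trivial_limit_at_left_real)
    then have "0 \<le> (1 - t) * side j z + t * side j b" by (subst side_combination[symmetric]) (rule nonneg)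
    moreover have "t * side j b < 0" using t b by (simp add: mult_neg_pos)
    ultimately have "0 < (1 - t) * side j z" by linarith
    then show "0 < side j z" using t by (simp add: zero_less_mult_iff)
  qed
qed

lemma polygon_curve_vs: "polygon_curve vs = {z. (\<forall>j<4. 0 \<le> side j z) \<and> (\<exists>j<4. side j z = 0)}"
  unfolding polygon_curve_def using mem_closed_edge by auto

lemma convex_polygon_vs: "convex_polygon vs"
proof -
  have "\<not> collinear {vertex vs i, vertex vs (i + 1), vertex vs (i + 2)}" if "i < 4" for i
    using that p q by (elim less_4_cases) (simp_all add: not_collinear_pt algebra_simps)
  moreover have "closed (convex hull (set vs))"
    by (simp add: compact_imp_closed finite_imp_compact_convex_hull)
  then have "frontier (convex hull (set vs)) = polygon_curve vs"
    unfolding frontier_def closure_closed interior_hull polygon_curve_vs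
    by (auto simp: convex_hull_vs less_eq_real_def)
  moreover have "distinct vs" using p q by (auto simp: vs_def)
  ultimately show ?thesis unfolding convex_polygon_def by simp
qed

lemma inside_vs: "inside (polygon_curve vs) = {z. \<forall>j<4. 0 < side j z}"
  using inside_polygon_curve[OF convex_polygon_vs] interior_hull by simp


section \<open>The billiard map of a quadrilateral\<close>

lemma edge_unique: "i < 4 \<Longrightarrow> j < 4 \<Longrightarrow> z \<in> edge i \<Longrightarrow> z \<in> edge j \<Longrightarrow> i = j"
  by (metis mem_edge less_irrefl)

lemma edge_subset_curve:
  assumes i: "i < 4" and z: "z \<in> edge i"
  shows "z \<in> polygon_curve vs"
proof -
  have "0 \<le> side j z" if "j < 4" for j
    using z that unfolding mem_edge[OF i] by (cases "j = i") (simp_all add: less_imp_le)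
  moreover have "side i z = 0" using z mem_edge[OF i] by blast
  ultimately show ?thesis using i unfolding polygon_curve_vs by blast
qed

lemma set_vs: "set vs = vertex vs ` {..<4}"
  by (auto simp: vertex_def in_set_conv_nth image_iff)

text \<open>Two sides vanish at a vertex, but only one on an open edge.\<close>

lemma nonvertex_iff:
  assumes "z \<in> polygon_curve vs"
  shows "z \<notin> set vs \<longleftrightarrow> (\<exists>i<4. z \<in> edge i)"
proof
  assume nv: "z \<notin> set vs"
  obtain i where i: "i < 4" and "z \<in> closed_segment (vertex vs i) (vertex vs (i + 1))"
    using assms unfolding polygon_curve_def by auto
  moreover have "vertex vs k \<in> set vs" for k
    unfolding vertex_def by (rule nth_mem) simp
  ultimately show "\<exists>i<4. z \<in> edge i"
    using nv unfolding edge_def open_segment_def by blast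
next
  assume "\<exists>i<4. z \<in> edge i"
  then obtain i where i: "i < 4" "z \<in> edge i" by blast
  show "z \<notin> set vs"
  proof
    assume "z \<in> set vs"
    then obtain k where k: "k < 4" "z = vertex vs k" unfolding set_vs by auto
    then obtain l where "l < 4" "l \<noteq> k" "side l z = 0" by (metis adjacent_sides)
    moreover have "side k z = 0" using k side_vertex_self by simp
    ultimately show False using i k mem_edge by (metis less_irrefl)
  qed
qed

lemma edge_containing_eq:
  assumes "i < 4" "z \<in> edge i"
  shows "edge_containing vs z = edge i"
  unfolding edge_containing_def
proof (rule the_equality)
  show "edge i \<in> polygon_edges vs \<and> z \<in> edge i"
    using assms unfolding polygon_edges_def edge_def by auto
  show "E = edge i" if "E \<in> polygon_edges vs \<and> z \<in> E" for E
    using that edge_unique assms unfolding polygon_edges_def edge_def[symmetric] by auto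
qed

lemma tangent_line_eq:
  assumes "i < 4" "z \<in> edge i"
  shows "tangent_line vs z = span {dir i}"
  unfolding tangent_line_def edge_containing_eq[OF assms] unfolding edge_def dir_def
  by (rule span_differences_open_segment) (rule vertex_neq[OF assms(1)])

text \<open>As \<open>x\<close> lies on an open edge, convexity makes the whole open segment
  interior as soon as \<open>z\<close> is off the line of edge \<open>i\<close>. This replaces the
  containment condition by a single sign.\<close>

lemma mem_next_points:
  assumes i: "i < 4" and j: "j < 4" and x: "x \<in> edge i" and y: "y \<in> edge j"
  shows "z \<in> next_points vs (x, y) \<longleftrightarrow>
    z \<in> polygon_curve vs \<and> side j z = side j x \<and> 0 < side i z"
proof
  assume z: "z \<in> next_points vs (x, y)"
  then obtain r where r: "z = x + r *\<^sub>R dir j" "r *\<^sub>R dir j \<noteq> 0"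
    unfolding next_points_def by (auto simp: tangent_line_eq[OF j y] span_singleton)
  have "side j z = side j x" unfolding r(1) side_add_dir using slope_eq_0_iff[OF j j] by simp
  moreover have "(1 - 1/2) *\<^sub>R x + (1/2) *\<^sub>R z \<in> open_segment x z"
  proof -
    have "x \<noteq> z" using r by auto
    then show ?thesis unfolding in_segment by (intro conjI exI[of _ "1/2"]) simp_all
  qed
  then have "0 < side i ((1 - 1/2) *\<^sub>R x + (1/2) *\<^sub>R z)"
    using z i unfolding next_points_def inside_vs by blast
  then have "0 < side i z" unfolding side_combination using x i by (simp add: mem_edge)
  ultimately show "z \<in> polygon_curve vs \<and> side j z = side j x \<and> 0 < side i z"
    using z unfolding next_points_def by blast
next
  assume z: "z \<in> polygon_curve vs \<and> side j z = side j x \<and> 0 < side i z"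
  then obtain r where r: "z = x + r *\<^sub>R dir j" using parallel_if_side_eq[OF j] by metis
  have sx: "side i x = 0" "\<And>k. k < 4 \<Longrightarrow> k \<noteq> i \<Longrightarrow> 0 < side k x"
    using x mem_edge[OF i] by auto
  have "r *\<^sub>R dir j \<noteq> 0" using r z sx by auto
  moreover have "open_segment x z \<subseteq> inside (polygon_curve vs)"
  proof
    fix a assume "a \<in> open_segment x z"
    then obtain t where t: "0 < t" "t < 1" and a: "a = (1 - t) *\<^sub>R x + t *\<^sub>R z"
      unfolding in_segment by blast
    have "0 < side k a" if k: "k < 4" for k
    proof (cases "k = i")
      case True
      then show ?thesis using t z sx unfolding a side_combination by simp
    next
      case False
      have "0 \<le> side k z" using z k unfolding polygon_curve_vs by blast
      then show ?thesis using sx(2)[OF k False] t unfolding a side_combination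
        by (simp add: add_pos_nonneg)
    qed
    then show "a \<in> inside (polygon_curve vs)" unfolding inside_vs by blast
  qed
  moreover have "r *\<^sub>R dir j \<in> span {dir j}" by (simp add: span_base span_scale)
  ultimately show "z \<in> next_points vs (x, y)"
    using z r unfolding next_points_def by (auto simp: tangent_line_eq[OF j y])
qed

text \<open>The ray from \<open>x\<close> parallel to edge \<open>j\<close> enters the interior because edges \<open>i\<close> and \<open>j\<close> are not
  parallel; the next point is where it leaves.\<close>

lemma ex_next_point:
  assumes i: "i < 4" and j: "j < 4" and ij: "i \<noteq> j" and x: "x \<in> edge i"
  shows "\<exists>z. z \<in> polygon_curve vs \<and> side j z = side j x \<and> 0 < side i z"
proof -
  \<comment> \<open>The factor \<open>slope i j\<close> orients the direction inwards:
    \<open>side i\<close> grows at the rate of its square, whatever its sign.\<close>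
  define l where "l = slope i j *\<^sub>R dir j"
  have s: "slope i j \<noteq> 0" using slope_eq_0_iff[OF j i] ij by simp
  have l: "side k (x + t *\<^sub>R l) = side k x + t * (slope i j * slope k j)" for k t
    unfolding l_def using side_add_dir[of k x "t * slope i j" j] by simp
  have sx: "side i x = 0" "\<And>k. k < 4 \<Longrightarrow> k \<noteq> i \<Longrightarrow> 0 < side k x"
    using x mem_edge[OF i] by auto
  have "\<forall>\<^sub>F t in at_right (0::real). \<forall>k\<in>{..<4}. 0 < side k (x + t *\<^sub>R l)"
  proof (intro eventually_ball_finite ballI)
    fix k :: nat assume "k \<in> {..<4}"
    then have k: "k < 4" by simp
    show "\<forall>\<^sub>F t in at_right (0::real). 0 < side k (x + t *\<^sub>R l)"
    proof (cases "k = i")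
      case True
      have "\<forall>\<^sub>F t in at_right (0::real). 0 < t" by (simp add: eventually_at_filter)
      then show ?thesis
      proof eventually_elim
        case (elim t)
        then show ?case unfolding l True sx(1) using s by (auto simp: zero_less_mult_iff)
      qed
    next
      case False
      have "((\<lambda>t. side k x + t * (slope i j * slope k j)) \<longlongrightarrow>
          side k x + 0 * (slope i j * slope k j)) (at_right (0::real))"
        by (intro tendsto_intros)
      then show ?thesis unfolding l using sx(2)[OF k False] by (intro order_tendstoD(1)) simp_all
    qed
  qed simp
  moreover have "\<forall>\<^sub>F t in at_right (0::real). 0 < t" by (simp add: eventually_at_filter)
  ultimately have "\<forall>\<^sub>F t in at_right (0::real). 0 < t \<and> (\<forall>k\<in>{..<4}. 0 < side k (x + t *\<^sub>R l))"
    by eventually_elim (rule conjI)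
  then obtain t :: real where t: "0 < t" "\<And>k. k < 4 \<Longrightarrow> 0 < side k (x + t *\<^sub>R l)"
    by (metis (no_types, lifting) eventually_happens' trivial_limit_at_right_real lessThan_iff)
  have "l \<noteq> 0" using t(2)[OF i] sx by auto
  moreover have "x + t *\<^sub>R l \<in> interior (convex hull (set vs))" using t unfolding interior_hull by blast
  ultimately obtain r where r: "0 < r" "x + t *\<^sub>R l + r *\<^sub>R l \<in> frontier (convex hull (set vs))"
    using ray_to_frontier[OF finite_imp_bounded_convex_hull[OF finite_set]] by metis
  have "x + t *\<^sub>R l + r *\<^sub>R l = x + (t + r) *\<^sub>R l" by (simp add: algebra_simps)
  then have "x + (t + r) *\<^sub>R l \<in> polygon_curve vs"
    using r(2) convex_polygon_vs unfolding convex_polygon_def by metis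
  moreover have "side j (x + (t + r) *\<^sub>R l) = side j x"
    unfolding l using slope_eq_0_iff[OF j j] by simp
  moreover have "0 < side i (x + (t + r) *\<^sub>R l)"
    unfolding l sx(1) using s t(1) r(1) by (auto simp: zero_less_mult_iff)
  ultimately show ?thesis by blast
qed

text \<open>Contains the phase space, and unlike \<^const>\<open>max_phase_space\<close> it is easy to propagate forward.\<close>

definition edge_pairs :: "((real^2) \<times> (real^2)) set" where
  "edge_pairs = {(x, y). \<exists>i<4. \<exists>j<4. i \<noteq> j \<and> x \<in> edge i \<and> y \<in> edge j}"

lemma ex1_next_point:
  assumes "(x, y) \<in> edge_pairs"
  shows "\<exists>!z. z \<in> next_points vs (x, y)"
proof -
  obtain i j where ij: "i < 4" "j < 4" "i \<noteq> j" "x \<in> edge i" "y \<in> edge j"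
    using assms unfolding edge_pairs_def by blast
  obtain z where "z \<in> next_points vs (x, y)"
    using ex_next_point[OF ij(1-4)] mem_next_points[OF ij(1,2,4,5)] by blast
  then show ?thesis
    using next_points_unique[OF convex_polygon_vs edge_subset_curve[OF ij(1,4)] tangent_line_eq[OF ij(2,5)]]
    by metis
qed

lemma edge_pairs_subset: "edge_pairs \<subseteq> max_phase_space vs"
proof clarify
  fix x y assume xy: "(x, y) \<in> edge_pairs"
  then obtain i j where ij: "i < 4" "j < 4" "i \<noteq> j" "x \<in> edge i" "y \<in> edge j"
    unfolding edge_pairs_def by blast
  then show "(x, y) \<in> max_phase_space vs"
    using ex1_next_point[OF xy] edge_subset_curve nonvertex_iff unfolding max_phase_space_def by blast
qed

lemma billiard_map_eq:
  assumes "(x, y) \<in> edge_pairs" "z \<in> next_points vs (x, y)"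
  shows "billiard_map vs (x, y) = (y, z)"
  using the1_equality[OF ex1_next_point[OF assms(1)] assms(2)] by (simp add: billiard_map_def)

text \<open>A vertex \<open>x\<close> is ruled out because the swapped pair lies in
  \<open>singular_set vs 0\<close>. Equal edges are ruled out because \<open>side j z\<close> would
  have to be both zero and positive.\<close>

lemma phase_space_subset: "phase_space vs \<subseteq> edge_pairs"
proof clarify
  fix x y assume xy: "(x, y) \<in> phase_space vs"
  then have m: "x \<in> polygon_curve vs" "y \<in> polygon_curve vs" "y \<notin> set vs"
    and "\<exists>!z. z \<in> next_points vs (x, y)"
    unfolding phase_space_def max_phase_space_def by auto
  then obtain z where z: "z \<in> next_points vs (x, y)" by blast
  have "x \<notin> set vs"
  proof
    assume "x \<in> set vs"
    then have "(y, x) \<in> singular_set vs 0" using m by simp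
    then have "prod.swap (y, x) \<in> prod.swap ` (\<Union>i. singular_set vs i)" by blast
    then show False using xy unfolding phase_space_def by simp
  qed
  then obtain i j where i: "i < 4" "x \<in> edge i" and j: "j < 4" "y \<in> edge j"
    using m nonvertex_iff by metis
  have "i \<noteq> j"
  proof
    assume "i = j"
    then have "side j z = side j x" "0 < side j z" "side j x = 0"
      using z mem_next_points[OF i(1) j(1) i(2) j(2)] mem_edge[OF i(1)] i(2) by blast+
    then show False by simp
  qed
  then show "(x, y) \<in> edge_pairs" using i j unfolding edge_pairs_def by blast
qed

text \<open>Avoiding every \<open>singular_set\<close> passes to the image because each level is the
  preimage of the one before; level 0 keeps \<open>z\<close> off the vertices. The edges of
  \<open>y\<close> and \<open>z\<close> differ since \<open>side j z = side j x\<close> is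
  positive.\<close>

lemma forward_step:
  assumes "(x, y) \<in> edge_pairs" "\<And>n. (x, y) \<notin> singular_set vs n"
  obtains z where "billiard_map vs (x, y) = (y, z)" "z \<in> next_points vs (x, y)"
    "(y, z) \<in> edge_pairs" "\<And>n. (y, z) \<notin> singular_set vs n"
proof -
  obtain i j where ij: "i < 4" "j < 4" "i \<noteq> j" "x \<in> edge i" "y \<in> edge j"
    using assms unfolding edge_pairs_def by blast
  obtain z where z: "z \<in> next_points vs (x, y)"
    using ex1_next_point[OF assms(1)] by blast
  have b: "billiard_map vs (x, y) = (y, z)" using billiard_map_eq[OF assms(1) z] .
  have sing: "(y, z) \<notin> singular_set vs n" for n
    using assms(2)[of "Suc n"] edge_pairs_subset assms(1) b by auto
  have zc: "z \<in> polygon_curve vs" "side j z = side j x" using z ij mem_next_points by blast+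
  have "z \<notin> set vs" using sing[of 0] edge_subset_curve[OF ij(2,5)] by simp
  then obtain k where k: "k < 4" "z \<in> edge k" using nonvertex_iff[OF zc(1)] by blast
  have "0 < side j z" using zc(2) mem_edge[OF ij(1)] ij by metis
  then have "k \<noteq> j" using k mem_edge by force
  then have "(y, z) \<in> edge_pairs" using k ij unfolding edge_pairs_def by blast
  then show thesis using that b z sing by blast
qed

section \<open>Bi-infinite orbits along a prescribed edge sequence\<close>

text \<open>An orbit described without the billiard map, by conditions that survive time reversal.
  \<open>e n \<noteq> e (n + 2)\<close> replaces the requirement that the chord run through the
  interior.\<close>

definition chain :: "(int \<Rightarrow> nat) \<Rightarrow> (int \<Rightarrow> real^2) \<Rightarrow> bool" where
  "chain e x \<longleftrightarrow> (\<forall>n. e n < 4 \<and> e n \<noteq> e (n + 1) \<and> e n \<noteq> e (n + 2) \<and> x n \<in> edge (e n) \<and>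
     side (e (n + 1)) (x (n + 2)) = side (e (n + 1)) (x n))"

lemma chain_edge_pairs: "chain e x \<Longrightarrow> (x n, x (n + 1)) \<in> edge_pairs"
  unfolding chain_def edge_pairs_def by blast

lemma chain_billiard_map:
  assumes "chain e x"
  shows "billiard_map vs (x n, x (n + 1)) = (x (n + 1), x (n + 2))"
proof (rule billiard_map_eq[OF chain_edge_pairs[OF assms]])
  have c: "e m < 4" "x m \<in> edge (e m)" "e m \<noteq> e (m + 2)"
    "side (e (m + 1)) (x (m + 2)) = side (e (m + 1)) (x m)" for m
    using assms unfolding chain_def by blast+
  \<comment> \<open>\<open>x (n + 2)\<close> lies on an open edge other than \<open>e n\<close>,
    where \<open>side (e n)\<close> is positive.\<close>
  have "0 < side (e n) (x (n + 2))"
    using mem_edge[OF c(1), THEN iffD1, OF c(2), of "n + 2"] c(1,3)[of n] by blast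
  then show "x (n + 2) \<in> next_points vs (x n, x (n + 1))"
    using mem_next_points[OF c(1) c(1) c(2) c(2)] c(4) edge_subset_curve[OF c(1) c(2)] by blast
qed

text \<open>Time reversal: the defining conditions are symmetric, which excludes the swapped singular set.\<close>

lemma chain_reverse:
  assumes "chain e x"
  shows "chain (\<lambda>n. e (1 - n)) (\<lambda>n. x (1 - n))"
proof -
  have eq: "1 - (n + 1) = - n" "1 - (n + 2) = - n - 1" "- n + 1 = 1 - n" "- n - 1 + 1 = - n"
    "- n - 1 + 2 = 1 - n" for n :: int
    by simp_all
  show ?thesis
    unfolding chain_def eq
  proof
    fix n
    show "e (1 - n) < 4 \<and> e (1 - n) \<noteq> e (- n) \<and> e (1 - n) \<noteq> e (- n - 1) \<and> x (1 - n) \<in> edge (e (1 - n)) \<and>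
        side (e (- n)) (x (- n - 1)) = side (e (- n)) (x (1 - n))"
      using assms[unfolded chain_def, rule_format, of "1 - n"]
        assms[unfolded chain_def, rule_format, of "- n"]
        assms[unfolded chain_def, rule_format, of "- n - 1"]
      unfolding eq by metis
  qed
qed

text \<open>Level \<open>Suc i\<close> at time \<open>n\<close> is level \<open>i\<close> at time
  \<open>n + 1\<close>, so \<open>n\<close> must vary in the induction; at level 0 the second point
  would be a vertex, but it lies on an open edge.\<close>

lemma chain_not_singular:
  assumes "chain e x"
  shows "(x n, x (n + 1)) \<notin> singular_set vs i"
proof (induction i arbitrary: n)
  case 0
  have "e (n + 1) < 4" "x (n + 1) \<in> edge (e (n + 1))" using assms unfolding chain_def by blast+
  then show ?case using nonvertex_iff edge_subset_curve by auto
next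
  case (Suc i)
  show ?case using Suc[of "n + 1"] chain_billiard_map[OF assms] by (simp add: add.assoc)
qed

lemma chain_phase_space:
  assumes "chain e x"
  shows "(x 0, x 1) \<in> phase_space vs"
proof -
  have "(x 0, x 1) \<in> edge_pairs" using chain_edge_pairs[OF assms, of 0] by simp
  moreover have "(x 0, x 1) \<notin> singular_set vs i" for i
    using chain_not_singular[OF assms, of 0 i] by simp
  \<comment> \<open>The reflection \<open>n -> 1 - n\<close> exchanges 0 and 1, so the reversed
    chain starts at the swapped pair.\<close>
  moreover have "(x 1, x 0) \<notin> singular_set vs i" for i
    using chain_not_singular[OF chain_reverse[OF assms], of 0 i] by simp
  ultimately show ?thesis using edge_pairs_subset unfolding phase_space_def by auto
qed

lemma chain_iterate:
  assumes "chain e x"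
  shows "(billiard_map vs ^^ k) (x 0, x 1) = (x (int k), x (int k + 1))"
proof (induction k)
  case (Suc k)
  have eq: "int (Suc k) = int k + 1" "int k + 1 + 1 = int k + 2" by simp_all
  show ?case
    by (simp only: funpow.simps comp_apply Suc chain_billiard_map[OF assms, of "int k"] eq)
qed simp

section \<open>Forward orbits of points in a tile\<close>

text \<open>Rewrites the iterated pairs as one sequence of points. The induction also carries the
  avoidance of every \<open>singular_set\<close>, which keeps the next points off the
  vertices.\<close>

lemma forward_orbit:
  assumes "r \<in> phase_space vs"
  defines "z k \<equiv> fst ((billiard_map vs ^^ k) r)"
  shows "(z k, z (Suc k)) \<in> edge_pairs" and "z (Suc (Suc k)) \<in> next_points vs (z k, z (Suc k))"
proof -
  have pairs: "(billiard_map vs ^^ k) r \<in> edge_pairs \<and> (\<forall>n. (billiard_map vs ^^ k) r \<notin> singular_set vs n)" for k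
  proof (induction k)
    case 0
    then show ?case using assms(1) phase_space_subset unfolding phase_space_def by auto
  next
    case (Suc k)
    obtain a b where ab: "(billiard_map vs ^^ k) r = (a, b)" by fastforce
    obtain d where "billiard_map vs (a, b) = (b, d)" "(b, d) \<in> edge_pairs" "\<And>n. (b, d) \<notin> singular_set vs n"
      using Suc unfolding ab by (auto elim: forward_step)
    then show ?case by (simp add: ab)
  qed
  have step: "(billiard_map vs ^^ k) r = (z k, z (Suc k)) \<and>
      (\<exists>d. (billiard_map vs ^^ Suc k) r = (z (Suc k), d) \<and> d \<in> next_points vs (z k, z (Suc k)))" for k
  proof -
    obtain a b where ab: "(billiard_map vs ^^ k) r = (a, b)" by fastforce
    obtain d where d: "billiard_map vs (a, b) = (b, d)" "d \<in> next_points vs (a, b)"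
      using pairs[of k] unfolding ab by (auto elim: forward_step)
    then have "z k = a" "z (Suc k) = b" unfolding z_def by (simp_all add: ab)
    then show ?thesis using ab d by simp
  qed
  show "(z k, z (Suc k)) \<in> edge_pairs" using pairs[of k] step[of k] by simp
  show "z (Suc (Suc k)) \<in> next_points vs (z k, z (Suc k))"
    using step[of k] step[of "Suc k"] by auto
qed

lemma symbolic_trajectory_nonneg:
  "symbolic_trajectory vs r (int k) = edge_containing vs (fst ((billiard_map vs ^^ k) r))"
  by (simp add: symbolic_trajectory_def trajectory_def orbit_def)

text \<open>Equal symbolic trajectories place \<open>z k\<close> on the edges prescribed by
  \<open>e\<close>, and the next-point condition is then the same linear recurrence as for the
  chain. Only nonnegative times occur, hence no inverse of the map.\<close>

lemma tile_chain:
  assumes c: "chain e x" and r: "r \<in> tile vs (x 0, x 1)"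
  defines "z k \<equiv> fst ((billiard_map vs ^^ k) r)"
  shows "z k \<in> edge (e (int k))"
    and "side (e (int k + 1)) (z (Suc (Suc k))) = side (e (int k + 1)) (z k)"
proof -
  have e: "e m < 4" "x m \<in> edge (e m)" for m using c unfolding chain_def by blast+
  have r': "r \<in> phase_space vs" using r unfolding tile_def by blast
  have edge: "z k \<in> edge (e (int k))" for k
  proof -
    have "edge_containing vs (z k) = edge_containing vs (x (int k))"
      using r symbolic_trajectory_nonneg[of r k] symbolic_trajectory_nonneg[of "(x 0, x 1)" k] chain_iterate[OF c]
      unfolding tile_def z_def by simp
    also have "\<dots> = edge (e (int k))" using e by (intro edge_containing_eq)
    finally have "edge_containing vs (z k) = edge (e (int k))" .
    moreover obtain i where "i < 4" "z k \<in> edge i"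
      using forward_orbit(1)[OF r', of k] unfolding z_def edge_pairs_def by blast
    ultimately show ?thesis using edge_containing_eq by metis
  qed
  then show "z k \<in> edge (e (int k))" .
  have "z (Suc k) \<in> edge (e (int k + 1))" using edge[of "Suc k"] by (metis of_nat_Suc add.commute)
  then show "side (e (int k + 1)) (z (Suc (Suc k))) = side (e (int k + 1)) (z k)"
    using forward_orbit(2)[OF r', of k] mem_next_points[OF e(1) e(1) edge] unfolding z_def by blast
qed

section \<open>The period-6 orbit\<close>


text \<open>Common denominator of the fixed points: with
  \<open>l = p * q / ((1 - p) * (1 - q))\<close>, \<open>p * q / denom\<close> equals
  \<open>l / (1 + l)\<close>.\<close>

definition denom :: real where
  "denom = p * q + (1 - p) * (1 - q)"

definition word :: "int \<Rightarrow> nat" where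
  "word n = [0, 2, 3, 1, 2, 3] ! nat (n mod 6)"

text \<open>Even and odd entries are the fixed points of the two six-step maps, solved for explicitly.\<close>

definition hexagon :: "int \<Rightarrow> real^2" where
  "hexagon n =
    (let a = p * q / denom; b = q * (1 - q) / denom; m = p * (1 - p) / denom
     in [pt a b, pt 0 a, pt a 0, pt m a, pt 0 b, pt m 0] ! nat (n mod 6))"

lemma chain_hexagon: "chain word hexagon"
proof -
  define a b m where "a = p * q / denom" and "b = q * (1 - q) / denom"
    and "m = p * (1 - p) / denom"
  have D: "0 < denom" using p q unfolding denom_def by (simp add: add_pos_pos)
  have pos: "0 < a" "0 < b" "0 < m" using D p q by (simp_all add: a_def b_def m_def)
  have "p * q < denom" using p q unfolding denom_def by simp
  then have a1: "a < 1" using D by (simp add: a_def)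
  \<comment> \<open>\<open>denom - 2 * (q * (1 - q))\<close> factors as this product. The resulting
    \<open>b < 1/2\<close> keeps \<open>pt a b\<close> off edge 1, since by \<open>e1\<close> below
    \<open>side 1\<close> equals \<open>p - 2 * p * b\<close> there. Exchanging \<open>p\<close> and
    \<open>q\<close> gives \<open>m < 1/2\<close>, which keeps \<open>pt m a\<close> off edge
    0.\<close>
  have "0 < (2 * q - 1) * (p + q - 1)" using p q by (intro mult_pos_pos) auto
  then have "2 * (q * (1 - q)) < denom" unfolding denom_def by (simp add: algebra_simps)
  then have b2: "b < 1/2" using D by (simp add: b_def field_simps)
  have "0 < (2 * p - 1) * (p + q - 1)" using p q by (intro mult_pos_pos) auto
  then have "2 * (p * (1 - p)) < denom" unfolding denom_def by (simp add: algebra_simps)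
  then have m2: "m < 1/2" using D by (simp add: m_def field_simps)
  \<comment> \<open>\<open>e1\<close> makes the chord from \<open>pt a 0\<close> to
    \<open>pt 0 b\<close> parallel to edge 1, \<open>e2\<close> the one from \<open>pt m 0\<close>
    to \<open>pt 0 a\<close> parallel to edge 0; \<open>e3\<close> and \<open>e4\<close> put
    \<open>pt a b\<close> on edge 0 and \<open>pt m a\<close> on edge 1.\<close>
  have e1: "(1 - q) * a = p * b" and e2: "(1 - p) * a = q * m"
    by (simp_all add: a_def b_def m_def)
  have e3: "q * a + (1 - p) * b = q" and e4: "(1 - q) * m + p * a = p"
    using D unfolding a_def b_def m_def
    by (simp_all add: field_simps) (simp_all add: denom_def algebra_simps)
  have lt: "p * b < p * (1/2)" "q * m < q * (1/2)" "q * a < q" "p * a < p"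
    using p q pos a1 b2 m2 by simp_all
  have "(1 - p) * b < 1 * b" "(1 - q) * m < 1 * m"
    using p q pos by (intro mult_strict_right_mono; simp)+
  then have lt': "(1 - p) * b < q" "(1 - q) * m < p" using p q b2 m2 by linarith+
  have word: "word n = [0, 2, 3, 1, 2, 3] ! nat (n mod 6)"
    and hexagon: "hexagon n = [pt a b, pt 0 a, pt a 0, pt m a, pt 0 b, pt m 0] ! nat (n mod 6)" for n
    by (simp_all add: word_def hexagon_def a_def b_def m_def Let_def)
  show ?thesis
    unfolding chain_def
  proof
    fix n :: int
    have "(n + j) mod 6 = (n mod 6 + j) mod 6" for j by (simp add: mod_add_left_eq)
    moreover have "0 \<le> n mod 6" "n mod 6 < 6" by simp_all
    then have "n mod 6 = 0 \<or> n mod 6 = 1 \<or> n mod 6 = 2 \<or> n mod 6 = 3 \<or> n mod 6 = 4 \<or> n mod 6 = 5"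
      by linarith
    ultimately have "n mod 6 = 0 \<and> (n + 1) mod 6 = 1 \<and> (n + 2) mod 6 = 2 \<or>
      n mod 6 = 1 \<and> (n + 1) mod 6 = 2 \<and> (n + 2) mod 6 = 3 \<or>
      n mod 6 = 2 \<and> (n + 1) mod 6 = 3 \<and> (n + 2) mod 6 = 4 \<or>
      n mod 6 = 3 \<and> (n + 1) mod 6 = 4 \<and> (n + 2) mod 6 = 5 \<or>
      n mod 6 = 4 \<and> (n + 1) mod 6 = 5 \<and> (n + 2) mod 6 = 0 \<or>
      n mod 6 = 5 \<and> (n + 1) mod 6 = 0 \<and> (n + 2) mod 6 = 1"
      by (elim disjE) (simp_all del: mod_add_left_eq)
    then show "word n < 4 \<and> word n \<noteq> word (n + 1) \<and> word n \<noteq> word (n + 2) \<and> hexagon n \<in> edge (word n) \<and>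
        side (word (n + 1)) (hexagon (n + 2)) = side (word (n + 1)) (hexagon n)"
      using p q a1 b2 m2 e1 e2 e3 e4 lt lt'
      by (elim disjE conjE) (simp_all add: pos word hexagon mem_edge all_less_4)
  qed
qed

text \<open>The odd-indexed points visit edges 2, 1, 3 in turn, and from one visit of edge 2 to the
  next the height \<open>c\<close> becomes \<open>l * (1 - c)\<close>. Heights on edge 2 stay in the
  unit interval, so \<open>c 0\<close> must be the fixed point of this expanding map.\<close>

lemma tile_hexagon:
  assumes "r \<in> tile vs (hexagon 0, hexagon 1)"
  defines "l \<equiv> p * q / ((1 - p) * (1 - q))"
  shows "snd r = pt 0 (l / (1 + l))"
proof -
  define z where "z k = fst ((billiard_map vs ^^ k) r)" for k
  note tc = tile_chain[OF chain_hexagon assms(1), folded z_def]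
  define c where "c k = yc (z (6 * k + 1))" for k
  have w: "word (int (6 * k + 1)) = 2" "word (int (6 * k + 1) + 1) = 3"
    "word (int (6 * k + 3)) = 1" "word (int (6 * k + 3) + 1) = 2"
    "word (int (6 * k + 5)) = 3" "word (int (6 * k + 5) + 1) = 0" for k
  proof -
    have m: "int (6 * k + 1) mod 6 = 1" "(int (6 * k + 1) + 1) mod 6 = 2"
      "int (6 * k + 3) mod 6 = 3" "(int (6 * k + 3) + 1) mod 6 = 4"
      "int (6 * k + 5) mod 6 = 5" "(int (6 * k + 5) + 1) mod 6 = 0"
      by simp_all
    show "word (int (6 * k + 1)) = 2" "word (int (6 * k + 1) + 1) = 3"
      "word (int (6 * k + 3)) = 1" "word (int (6 * k + 3) + 1) = 2"
      "word (int (6 * k + 5)) = 3" "word (int (6 * k + 5) + 1) = 0"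
      unfolding word_def m by simp_all
  qed
  have E: "xc (z (6 * k + 1)) = 0" "0 < c k" "c k < 1" for k
  proof -
    have E: "xc (z (6 * k + 1)) = 0" "0 < c k" "p * c k < p * 1"
      using tc(1)[of "6 * k + 1"] unfolding w c_def by (auto simp: mem_edge all_less_4)
    show "xc (z (6 * k + 1)) = 0" "0 < c k" by (fact E)+
    show "c k < 1" using E(3) p by (simp only: mult_less_cancel_left_pos)
  qed
  have rec: "c (Suc k) = l * (1 - c k)" for k
  proof -
    have s: "Suc (Suc (6 * k + 1)) = 6 * k + 3" "Suc (Suc (6 * k + 3)) = 6 * k + 5"
      "Suc (Suc (6 * k + 5)) = 6 * Suc k + 1" by simp_all
    \<comment> \<open>A horizontal chord leads to edge 1, a vertical one to edge 3, and a chord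
      parallel to edge 0 back to edge 2.\<close>
    have 1: "yc (z (6 * k + 3)) = c k" using tc(2)[of "6 * k + 1"] unfolding w s c_def by simp
    have 2: "(1 - q) * xc (z (6 * k + 3)) + p * c k = p"
      using tc(1)[of "6 * k + 3"] 1 unfolding w by (auto simp: mem_edge)
    have 3: "xc (z (6 * k + 5)) = xc (z (6 * k + 3))" using tc(2)[of "6 * k + 3"] unfolding w s by simp
    have 4: "yc (z (6 * k + 5)) = 0" using tc(1)[of "6 * k + 5"] unfolding w by (auto simp: mem_edge)
    have "q * xc (z (6 * k + 5)) = (1 - p) * c (Suc k)"
      using tc(2)[of "6 * k + 5"] E(1)[of "Suc k"] 4 unfolding w s c_def by simp
    then have "c (Suc k) = q * xc (z (6 * k + 5)) / (1 - p)" using p by simp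
    also have "xc (z (6 * k + 5)) = p * (1 - c k) / (1 - q)"
      using 2 3 q by (simp add: field_simps)
    finally show ?thesis by (simp add: l_def mult_ac)
  qed
  \<comment> \<open>\<open>1 - p < p\<close> and \<open>1 - q < q\<close>, so the odd map
    expands.\<close>
  have "(1 - p) * (1 - q) < p * q" using p q by (intro mult_strict_mono) auto
  then have "1 < l" using p q by (simp add: l_def)
  then have "c 0 = l / (1 + l)"
    using bounded_expanding_recurrence[of c l] rec E by (simp add: less_imp_le)
  \<comment> \<open>The first component after one step is by definition the old second
    component.\<close>
  moreover have "snd r = z 1"
    by (cases r) (simp add: z_def billiard_map_def)
  ultimately show ?thesis
    using E(1)[of 0] pt_coords[of "z 1"] unfolding c_def by simp
qed

lemma isolated_periodic_hexagon: "isolated_periodic vs (hexagon 0, hexagon 1)"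
  unfolding isolated_periodic_def
proof (intro conjI)
  show "(hexagon 0, hexagon 1) \<in> phase_space vs" by (rule chain_phase_space[OF chain_hexagon])
  have "(billiard_map vs ^^ 6) (hexagon 0, hexagon 1) = (hexagon (int 6), hexagon (int 6 + 1))"
    by (rule chain_iterate[OF chain_hexagon])
  also have "\<dots> = (hexagon 0, hexagon 1)" by (simp add: hexagon_def)
  finally show "\<exists>n\<ge>1. (billiard_map vs ^^ n) (hexagon 0, hexagon 1) = (hexagon 0, hexagon 1)"
    by (intro exI[of _ 6]) simp
  define l where "l = p * q / ((1 - p) * (1 - q))"
  have "snd r = pt 0 (l / (1 + l))" if "r \<in> tile vs (hexagon 0, hexagon 1)" for r
    unfolding l_def by (rule tile_hexagon[OF that])
  then have "tile vs (hexagon 0, hexagon 1) \<subseteq> UNIV \<times> {pt 0 (l / (1 + l))}"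
    by (auto simp: mem_Times_iff)
  then show "tile vs (hexagon 0, hexagon 1) \<in> null_sets (completion (arc_length vs \<Otimes>\<^sub>M arc_length vs))"
    by (intro null_sets_arc_length_strip) (use vertex_neq in simp_all)
qed

end

section \<open>The open, affinely invariant family\<close>

lemma det2_matrix_vector_mult: "det2 (A *v a) (A *v b) = det A * det2 a b"
  for A :: "real^2^2"
  by (simp add: det2_def det_2 matrix_vector_mult_def sum_2 algebra_simps)

text \<open>The inequalities say \<open>1/2 < n / d < 1\<close> and \<open>1/2 < m / d < 1\<close> for the coordinates \<open>(n / d, m / d)\<close> of
  \<open>v2\<close> in the frame with origin \<open>v4\<close>; being polynomial and homogeneous in the determinants, they are
  visibly open and affinely invariant, and they force \<open>d \<noteq> 0\<close>.\<close>

definition family :: "((real^2) \<times> (real^2) \<times> (real^2) \<times> (real^2)) set" where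
  "family = {(v1, v2, v3, v4).
     let d = det2 (v1 - v4) (v3 - v4); n = det2 (v2 - v4) (v3 - v4); m = det2 (v1 - v4) (v2 - v4)
     in d * d < 2 * n * d \<and> n * d < d * d \<and> d * d < 2 * m * d \<and> m * d < d * d}"

text \<open>The frame has origin \<open>v4\<close> and axes towards \<open>v1\<close> and
  \<open>v3\<close>, so the coordinates of \<open>v2\<close> serve as \<open>p\<close> and
  \<open>q\<close>.\<close>

lemma family_quadrilateral:
  assumes "(v1, v2, v3, v4) \<in> family"
  obtains c u w p q where "quadrilateral u w p q" "[v1, v2, v3, v4] = quadrilateral.vs c u w p q"
proof -
  define d where "d = det2 (v1 - v4) (v3 - v4)"
  interpret affine_frame v4 "v1 - v4" "v3 - v4"
    using assms by unfold_locales (auto simp: family_def Let_def)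
  have d: "d \<noteq> 0" using frame by (simp add: d_def)
  have coords: "xc v2 = det2 (v2 - v4) (v3 - v4) / d" "yc v2 = det2 (v1 - v4) (v2 - v4) / d"
    by (simp_all add: xc_def yc_def d_def)
  have "0 < d * d" using d by (auto simp: zero_less_mult_iff)
  \<comment> \<open>Expanding the fraction by \<open>d\<close> makes the denominator
    \<open>d * d\<close> positive, so the equivalences hold for both orientations of the
    vertices.\<close>
  moreover have "n / d = n * d / (d * d)" for n using d by simp
  ultimately have "1/2 < n / d \<longleftrightarrow> d * d < 2 * n * d" "n / d < 1 \<longleftrightarrow> n * d < d * d" for n
    by (simp_all only: pos_less_divide_eq pos_divide_less_eq) auto
  then interpret quadrilateral v4 "v1 - v4" "v3 - v4" "xc v2" "yc v2"
    using assms unfolding coords by unfold_locales (simp_all add: family_def d_def Let_def)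
  have "quadrilateral (v1 - v4) (v3 - v4) (xc v2) (yc v2)" by unfold_locales
  moreover have "[v1, v2, v3, v4] = vs"
    using pt_coords[of v2] unfolding vs_def by (simp add: pt_def)
  ultimately show thesis by (rule that)
qed

theorem theorem1p3:
  "\<exists>U :: ((real^2) \<times> (real^2) \<times> (real^2) \<times> (real^2)) set.
     open U \<and> U \<noteq> {} \<and>
     (\<forall>(v1, v2, v3, v4) \<in> U. convex_polygon [v1, v2, v3, v4]) \<and>
     (\<forall>(v1, v2, v3, v4) \<in> U. \<forall>(A :: real^2^2) (b :: real^2). invertible A \<longrightarrow>
        (A *v v1 + b, A *v v2 + b, A *v v3 + b, A *v v4 + b) \<in> U) \<and>
     (\<forall>(v1, v2, v3, v4) \<in> U. \<exists>p. isolated_periodic [v1, v2, v3, v4] p)"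
proof (intro exI[of _ family] conjI)
  have "family = {v. let d = det2 (fst v - snd (snd (snd v))) (fst (snd (snd v)) - snd (snd (snd v)));
      n = det2 (fst (snd v) - snd (snd (snd v))) (fst (snd (snd v)) - snd (snd (snd v)));
      m = det2 (fst v - snd (snd (snd v))) (fst (snd v) - snd (snd (snd v)))
     in d * d < 2 * n * d \<and> n * d < d * d \<and> d * d < 2 * m * d \<and> m * d < d * d}"
    by (auto simp: family_def)
  also have "open \<dots>"
    unfolding det2_def Let_def
    by (intro open_Collect_conj open_Collect_less continuous_intros)
  finally show "open family" .
  \<comment> \<open>The sample member is \<open>p = q = 3/4\<close> in the standard frame.\<close>
  have "(axis 1 1, (3/4) *\<^sub>R axis 1 1 + (3/4) *\<^sub>R axis 2 1, axis 2 1, 0) \<in> family"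
    by (simp add: family_def det2_def axis_def)
  then show "family \<noteq> {}" by blast
  show "\<forall>(v1, v2, v3, v4) \<in> family. convex_polygon [v1, v2, v3, v4]"
    using family_quadrilateral quadrilateral.convex_polygon_vs by (auto, metis)
  show "\<forall>(v1, v2, v3, v4) \<in> family. \<exists>p. isolated_periodic [v1, v2, v3, v4] p"
    using family_quadrilateral quadrilateral.isolated_periodic_hexagon by (auto, metis)
  show "\<forall>(v1, v2, v3, v4) \<in> family. \<forall>(A :: real^2^2) (b :: real^2). invertible A \<longrightarrow>
        (A *v v1 + b, A *v v2 + b, A *v v3 + b, A *v v4 + b) \<in> family"
  proof clarify
    fix v1 v2 v3 v4 b :: "real^2" and A :: "real^2^2"
    assume v: "(v1, v2, v3, v4) \<in> family" and "invertible A"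
    \<comment> \<open>Each inequality of \<open>family\<close> compares quadratic forms in
      determinants, so \<open>A\<close> multiplies both sides by the square of \<open>det A\<close>,
      positive even when orientation is reversed.\<close>
    then have "0 < det A * det A" by (auto simp: invertible_det_nz zero_less_mult_iff)
    moreover have "(A *v x + b) - (A *v y + b) = A *v (x - y)" for x y
      by (simp add: matrix_vector_mult_diff_distrib)
    moreover have "(det A * x) * (det A * y) = (det A * det A) * (x * y)"
      "2 * (det A * x) * (det A * y) = (det A * det A) * (2 * x * y)" for x y
      by simp_all
    ultimately show "(A *v v1 + b, A *v v2 + b, A *v v3 + b, A *v v4 + b) \<in> family"
      using v unfolding family_def Let_def mem_Collect_eq prod.case det2_matrix_vector_mult
      by (simp only: det2_matrix_vector_mult mult_less_cancel_left_pos)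
  qed
qed

end
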